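(* Let $\mathcal{P}:|\mathcal{P}|\to\mathcal{E}$ be a totally connected tripos on a Boolean topos $\mathcal{E}$. Then for any $A\in\mathcal{E}$ and $\varphi\in\mathcal{P}_A$, we have $\delta\pi\varphi\cong\neg\neg\varphi$.
   Context: A tripos on a cartesian closed category $\mathcal{E}$ is a fibration of preorders $\mathcal{P}:|\mathcal{P}|\to\mathcal{E}$ (fibers $\mathcal{P}_A$, reindexing $u^*$) such that all fibers are Heyting pre-algebras with structure preserved by reindexing; all reindexing functions have right adjoints satisfying the Beck–Chevalley condition; and there is a generic predicate $\mathsf{tr}\in\mathcal{P}_{\mathsf{Prop}}$, i.e. every $\varphi\in\mathcal{P}_A$ is isomorphic to $f^*\mathsf{tr}$ for some $f:A\to\mathsf{Prop}$. Existential quantification $\exists_u\dashv u^*$ (with Beck–Chevalley and Frobenius) is then definable. The tripos is regular, i.e. a pre-stack, if $e^*\varphi\le e^*\psi$ implies $\varphi\le\psi$ for every epimorphism $e$; it is then a fibered frame (a fibered preorder with reindexing-stable finite meets, existential quantification with Beck–Chevalley and Frobenius, and the pre-stack property). Let $\mathrm{sub}(\mathcal{E})$ be the subobject fibration. The fibered monotone map $\delta:\mathrm{sub}(\mathcal{E})\to\mathcal{P}$ sends $m:U\rightarrowtail A$ to $\exists_m\top\in\mathcal{P}_A$. A fibered frame $\mathcal{P}$ (here: a regular tripos) is called totally connected if $\delta$ has a finite meet preserving (fibered) left adjoint $\pi:\mathcal{P}\to\mathrm{sub}(\mathcal{E})$. Negation in the fibers is $\neg\varphi=\varphi\Rightarrow\bot$,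 and $\cong$ is equivalence in the preorder $\mathcal{P}_A$. *)

theory Defs
  imports "HOL-Algebra.Lattice"
begin

section \<open>Categories\<close>

record ('o, 'm) cat =
  Obj :: "'o set"
  Mor :: "'m set"
  Dom :: "'m \<Rightarrow> 'o"
  Cod :: "'m \<Rightarrow> 'o"
  Idn :: "'o \<Rightarrow> 'm"
  Comp :: "'m \<Rightarrow> 'm \<Rightarrow> 'm"  (infixl \<open>\<cdot>\<index>\<close> 75)

text \<open>Composition is in applicative order: \<open>g \<cdot> f\<close> is \<open>f\<close> followed by \<open>g\<close>.\<close>

definition Hom :: "('o, 'm) cat \<Rightarrow> 'o \<Rightarrow> 'o \<Rightarrow> 'm set" where
  "Hom C A B = {f \<in> Mor C. Dom C f = A \<and> Cod C f = B}"

locale category =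
  fixes C :: "('o, 'm) cat" (structure)
  assumes Dom_Obj: "f \<in> Mor C \<Longrightarrow> Dom C f \<in> Obj C"
    and Cod_Obj: "f \<in> Mor C \<Longrightarrow> Cod C f \<in> Obj C"
    and Idn_Hom: "A \<in> Obj C \<Longrightarrow> Idn C A \<in> Hom C A A"
    and Comp_Hom: "\<lbrakk>f \<in> Hom C A B; g \<in> Hom C B D\<rbrakk> \<Longrightarrow> g \<cdot> f \<in> Hom C A D"
    and Idn_right: "f \<in> Hom C A B \<Longrightarrow> f \<cdot> Idn C A = f"
    and Idn_left: "f \<in> Hom C A B \<Longrightarrow> Idn C B \<cdot> f = f"
    and Comp_assoc: "\<lbrakk>f \<in> Hom C A B; g \<in> Hom C B D; h \<in> Hom C D E\<rbrakk>
      \<Longrightarrow> h \<cdot> (g \<cdot> f) = (h \<cdot> g) \<cdot> f"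

definition monic :: "('o, 'm) cat \<Rightarrow> 'm \<Rightarrow> bool" where
  "monic C m \<longleftrightarrow> m \<in> Mor C \<and>
     (\<forall>X\<in>Obj C. \<forall>f\<in>Hom C X (Dom C m). \<forall>g\<in>Hom C X (Dom C m). m \<cdot>\<^bsub>C\<^esub> f = m \<cdot>\<^bsub>C\<^esub> g \<longrightarrow> f = g)"

definition epic :: "('o, 'm) cat \<Rightarrow> 'm \<Rightarrow> bool" where
  "epic C e \<longleftrightarrow> e \<in> Mor C \<and>
     (\<forall>X\<in>Obj C. \<forall>f\<in>Hom C (Cod C e) X. \<forall>g\<in>Hom C (Cod C e) X. f \<cdot>\<^bsub>C\<^esub> e = g \<cdot>\<^bsub>C\<^esub> e \<longrightarrow> f = g)"

definition is_terminal :: "('o, 'm) cat \<Rightarrow> 'o \<Rightarrow> bool" where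
  "is_terminal C T \<longleftrightarrow> T \<in> Obj C \<and> (\<forall>X\<in>Obj C. \<exists>!f. f \<in> Hom C X T)"

definition is_product :: "('o, 'm) cat \<Rightarrow> 'o \<Rightarrow> 'o \<Rightarrow> 'o \<Rightarrow> 'm \<Rightarrow> 'm \<Rightarrow> bool" where
  "is_product C A B P p q \<longleftrightarrow> p \<in> Hom C P A \<and> q \<in> Hom C P B \<and>
     (\<forall>X\<in>Obj C. \<forall>f\<in>Hom C X A. \<forall>g\<in>Hom C X B.
        \<exists>!h. h \<in> Hom C X P \<and> p \<cdot>\<^bsub>C\<^esub> h = f \<and> q \<cdot>\<^bsub>C\<^esub> h = g)"

text \<open>The square is \<open>f \<cdot> p = g \<cdot> q\<close>.\<close>

definition is_pullback :: "('o, 'm) cat \<Rightarrow> 'm \<Rightarrow> 'm \<Rightarrow> 'm \<Rightarrow> 'm \<Rightarrow> bool" where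
  "is_pullback C f g p q \<longleftrightarrow>
     f \<in> Mor C \<and> g \<in> Mor C \<and> Cod C f = Cod C g \<and>
     p \<in> Hom C (Dom C p) (Dom C f) \<and> q \<in> Hom C (Dom C p) (Dom C g) \<and> f \<cdot>\<^bsub>C\<^esub> p = g \<cdot>\<^bsub>C\<^esub> q \<and>
     (\<forall>X\<in>Obj C. \<forall>a\<in>Hom C X (Dom C f). \<forall>b\<in>Hom C X (Dom C g). f \<cdot>\<^bsub>C\<^esub> a = g \<cdot>\<^bsub>C\<^esub> b \<longrightarrow>
        (\<exists>!h. h \<in> Hom C X (Dom C p) \<and> p \<cdot>\<^bsub>C\<^esub> h = a \<and> q \<cdot>\<^bsub>C\<^esub> h = b))"

text \<open>\<open>Y\<close> is the exponential \<open>B\<^sup>A\<close>, with evaluation \<open>ev\<close> defined on the product \<open>(P, p, q)\<close>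
  of \<open>Y\<close> and \<open>A\<close>; the arrow \<open>h\<close> below is \<open>g \<times> id\<^sub>A\<close>.\<close>

definition is_exponential ::
    "('o, 'm) cat \<Rightarrow> 'o \<Rightarrow> 'o \<Rightarrow> 'o \<Rightarrow> 'o \<Rightarrow> 'm \<Rightarrow> 'm \<Rightarrow> 'm \<Rightarrow> bool" where
  "is_exponential C A B Y P p q ev \<longleftrightarrow> is_product C Y A P p q \<and> ev \<in> Hom C P B \<and>
     (\<forall>X\<in>Obj C. \<forall>Q r s. is_product C X A Q r s \<longrightarrow> (\<forall>f\<in>Hom C Q B.
        \<exists>!g. g \<in> Hom C X Y \<and>
          (\<exists>h\<in>Hom C Q P. p \<cdot>\<^bsub>C\<^esub> h = g \<cdot>\<^bsub>C\<^esub> r \<and> q \<cdot>\<^bsub>C\<^esub> h = s \<and> ev \<cdot>\<^bsub>C\<^esub> h = f)))"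

definition cartesian_closed :: "('o, 'm) cat \<Rightarrow> bool" where
  "cartesian_closed C \<longleftrightarrow> category C \<and>
     (\<exists>T. is_terminal C T) \<and>
     (\<forall>A\<in>Obj C. \<forall>B\<in>Obj C. \<exists>P p q. is_product C A B P p q) \<and>
     (\<forall>A\<in>Obj C. \<forall>B\<in>Obj C. \<exists>Y P p q ev. is_exponential C A B Y P p q ev)"

definition has_pullbacks :: "('o, 'm) cat \<Rightarrow> bool" where
  "has_pullbacks C \<longleftrightarrow>
     (\<forall>f\<in>Mor C. \<forall>g\<in>Mor C. Cod C f = Cod C g \<longrightarrow> (\<exists>p q. is_pullback C f g p q))"

definition is_subobject_classifier :: "('o, 'm) cat \<Rightarrow> 'o \<Rightarrow> 'm \<Rightarrow> bool" where
  "is_subobject_classifier C \<Omega> t \<longleftrightarrow>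
     t \<in> Mor C \<and> is_terminal C (Dom C t) \<and> Cod C t = \<Omega> \<and>
     (\<forall>m. monic C m \<longrightarrow> (\<exists>!\<chi>. \<chi> \<in> Hom C (Cod C m) \<Omega> \<and> (\<exists>k. is_pullback C \<chi> t m k)))"

text \<open>An elementary topos; a terminal object and pullbacks yield all finite limits.\<close>

definition topos :: "('o, 'm) cat \<Rightarrow> bool" where
  "topos C \<longleftrightarrow> cartesian_closed C \<and> has_pullbacks C \<and> (\<exists>\<Omega> t. is_subobject_classifier C \<Omega> t)"


section \<open>Preorders\<close>

text \<open>A preorder is represented as a weak partial order, whose equality \<open>.=\<close> is
  equivalence in the preorder. Lattice operations are chosen up to \<open>.=\<close>.\<close>

definition is_imp :: "'a gorder \<Rightarrow> 'a \<Rightarrow> 'a \<Rightarrow> 'a \<Rightarrow> bool" where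
  "is_imp L x y z \<longleftrightarrow> z \<in> carrier L \<and>
     (\<forall>w\<in>carrier L. w \<sqsubseteq>\<^bsub>L\<^esub> z \<longleftrightarrow> w \<sqinter>\<^bsub>L\<^esub> x \<sqsubseteq>\<^bsub>L\<^esub> y)"

definition imp :: "'a gorder \<Rightarrow> 'a \<Rightarrow> 'a \<Rightarrow> 'a" where
  "imp L x y = (SOME z. is_imp L x y z)"

definition neg :: "'a gorder \<Rightarrow> 'a \<Rightarrow> 'a" where
  "neg L x = imp L x \<bottom>\<^bsub>L\<^esub>"

definition heyting_prealgebra :: "'a gorder \<Rightarrow> bool" where
  "heyting_prealgebra L \<longleftrightarrow> weak_bounded_lattice L \<and>
     (\<forall>x\<in>carrier L. \<forall>y\<in>carrier L. \<exists>z. is_imp L x y z)"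

definition boolean_prealgebra :: "'a gorder \<Rightarrow> bool" where
  "boolean_prealgebra L \<longleftrightarrow> heyting_prealgebra L \<and>
     (\<forall>x\<in>carrier L. x \<squnion>\<^bsub>L\<^esub> neg L x .=\<^bsub>L\<^esub> \<top>\<^bsub>L\<^esub>)"

definition preserves_finite_meets :: "'a gorder \<Rightarrow> 'b gorder \<Rightarrow> ('a \<Rightarrow> 'b) \<Rightarrow> bool" where
  "preserves_finite_meets L M f \<longleftrightarrow>
     f \<top>\<^bsub>L\<^esub> .=\<^bsub>M\<^esub> \<top>\<^bsub>M\<^esub> \<and>
     (\<forall>x\<in>carrier L. \<forall>y\<in>carrier L. f (x \<sqinter>\<^bsub>L\<^esub> y) .=\<^bsub>M\<^esub> f x \<sqinter>\<^bsub>M\<^esub> f y)"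

definition preserves_heyting_structure :: "'a gorder \<Rightarrow> 'b gorder \<Rightarrow> ('a \<Rightarrow> 'b) \<Rightarrow> bool" where
  "preserves_heyting_structure L M f \<longleftrightarrow>
     preserves_finite_meets L M f \<and>
     f \<bottom>\<^bsub>L\<^esub> .=\<^bsub>M\<^esub> \<bottom>\<^bsub>M\<^esub> \<and>
     (\<forall>x\<in>carrier L. \<forall>y\<in>carrier L. f (x \<squnion>\<^bsub>L\<^esub> y) .=\<^bsub>M\<^esub> f x \<squnion>\<^bsub>M\<^esub> f y) \<and>
     (\<forall>x\<in>carrier L. \<forall>y\<in>carrier L. f (imp L x y) .=\<^bsub>M\<^esub> imp M (f x) (f y))"

text \<open>\<open>f\<close> is left adjoint to \<open>g\<close>. (The library's \<open>galois_connection\<close> requires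
  antisymmetric orders.)\<close>

definition adjunction :: "'a gorder \<Rightarrow> 'b gorder \<Rightarrow> ('a \<Rightarrow> 'b) \<Rightarrow> ('b \<Rightarrow> 'a) \<Rightarrow> bool" where
  "adjunction L M f g \<longleftrightarrow>
     f \<in> carrier L \<rightarrow> carrier M \<and> g \<in> carrier M \<rightarrow> carrier L \<and>
     isotone L M f \<and> isotone M L g \<and>
     (\<forall>x\<in>carrier L. \<forall>y\<in>carrier M. f x \<sqsubseteq>\<^bsub>M\<^esub> y \<longleftrightarrow> x \<sqsubseteq>\<^bsub>L\<^esub> g y)"


section \<open>Fibrations of preorders\<close>

record ('x, 'f, 'o, 'm) cfunctor =
  total :: "('x, 'f) cat"
  base :: "('o, 'm) cat"
  omap :: "'x \<Rightarrow> 'o"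
  mmap :: "'f \<Rightarrow> 'm"

definition is_functor :: "('x, 'f, 'o, 'm) cfunctor \<Rightarrow> bool" where
  "is_functor P \<longleftrightarrow> category (total P) \<and> category (base P) \<and>
     (\<forall>x\<in>Obj (total P). omap P x \<in> Obj (base P) \<and>
        mmap P (Idn (total P) x) = Idn (base P) (omap P x)) \<and>
     (\<forall>x y. \<forall>f\<in>Hom (total P) x y. mmap P f \<in> Hom (base P) (omap P x) (omap P y)) \<and>
     (\<forall>x y z. \<forall>f\<in>Hom (total P) x y. \<forall>g\<in>Hom (total P) y z.
        mmap P (g \<cdot>\<^bsub>total P\<^esub> f) = mmap P g \<cdot>\<^bsub>base P\<^esub> mmap P f)"

definition is_cartesian :: "('x, 'f, 'o, 'm) cfunctor \<Rightarrow> 'f \<Rightarrow> bool" where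
  "is_cartesian P f \<longleftrightarrow> f \<in> Mor (total P) \<and>
     (\<forall>z\<in>Obj (total P). \<forall>g\<in>Hom (total P) z (Cod (total P) f).
      \<forall>w\<in>Hom (base P) (omap P z) (omap P (Dom (total P) f)).
        mmap P g = mmap P f \<cdot>\<^bsub>base P\<^esub> w \<longrightarrow>
        (\<exists>!h. h \<in> Hom (total P) z (Dom (total P) f) \<and> mmap P h = w \<and> f \<cdot>\<^bsub>total P\<^esub> h = g))"

definition cartesian_lift :: "('x, 'f, 'o, 'm) cfunctor \<Rightarrow> 'm \<Rightarrow> 'x \<Rightarrow> 'f \<Rightarrow> bool" where
  "cartesian_lift P u y f \<longleftrightarrow> is_cartesian P f \<and> mmap P f = u \<and> Cod (total P) f = y"

definition fibration :: "('x, 'f, 'o, 'm) cfunctor \<Rightarrow> bool" where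
  "fibration P \<longleftrightarrow> is_functor P \<and>
     (\<forall>u\<in>Mor (base P). \<forall>y\<in>Obj (total P). omap P y = Cod (base P) u \<longrightarrow> (\<exists>f. cartesian_lift P u y f))"

text \<open>All fiber categories are preorders: parallel vertical arrows are equal.\<close>

definition preorder_fibration :: "('x, 'f, 'o, 'm) cfunctor \<Rightarrow> bool" where
  "preorder_fibration P \<longleftrightarrow> fibration P \<and>
     (\<forall>x y. \<forall>f\<in>Hom (total P) x y. \<forall>g\<in>Hom (total P) x y.
        omap P x = omap P y \<and> mmap P f = Idn (base P) (omap P x) \<and> mmap P g = Idn (base P) (omap P x)
        \<longrightarrow> f = g)"

definition vle :: "('x, 'f, 'o, 'm) cfunctor \<Rightarrow> 'o \<Rightarrow> 'x \<Rightarrow> 'x \<Rightarrow> bool" where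
  "vle P A x y \<longleftrightarrow> (\<exists>f\<in>Hom (total P) x y. mmap P f = Idn (base P) A)"

definition fiber :: "('x, 'f, 'o, 'm) cfunctor \<Rightarrow> 'o \<Rightarrow> 'x gorder" where
  "fiber P A =
     \<lparr>carrier = {x \<in> Obj (total P). omap P x = A},
      eq = (\<lambda>x y. vle P A x y \<and> vle P A y x),
      le = vle P A\<rparr>"

text \<open>\<open>reindex P u\<close> is \<open>u\<^sup>*\<close>, given by a choice of cartesian liftings.\<close>

definition reindex :: "('x, 'f, 'o, 'm) cfunctor \<Rightarrow> 'm \<Rightarrow> 'x \<Rightarrow> 'x" where
  "reindex P u y = Dom (total P) (SOME f. cartesian_lift P u y f)"

definition fibered_map ::
    "('x, 'f, 'o, 'm) cfunctor \<Rightarrow> ('y, 'g, 'o, 'm) cfunctor \<Rightarrow> ('x \<Rightarrow> 'y) \<Rightarrow> bool" where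
  "fibered_map P Q F \<longleftrightarrow> base P = base Q \<and>
     (\<forall>A\<in>Obj (base P). F \<in> carrier (fiber P A) \<rightarrow> carrier (fiber Q A) \<and>
        isotone (fiber P A) (fiber Q A) F) \<and>
     (\<forall>A B. \<forall>u\<in>Hom (base P) A B. \<forall>\<psi>\<in>carrier (fiber P B).
        F (reindex P u \<psi>) .=\<^bsub>fiber Q A\<^esub> reindex Q u (F \<psi>))"

definition fibered_left_adjoint ::
    "('x, 'f, 'o, 'm) cfunctor \<Rightarrow> ('y, 'g, 'o, 'm) cfunctor \<Rightarrow> ('x \<Rightarrow> 'y) \<Rightarrow> ('y \<Rightarrow> 'x) \<Rightarrow> bool" where
  "fibered_left_adjoint P Q F G \<longleftrightarrow> fibered_map P Q F \<and> fibered_map Q P G \<and>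
     (\<forall>A\<in>Obj (base P). adjunction (fiber P A) (fiber Q A) F G)"

text \<open>The subobject fibration. Objects are monomorphisms rather than equivalence classes of
  them; an arrow from \<open>m\<close> to \<open>n\<close> over \<open>u\<close> is the triple \<open>(m, u, n)\<close>, present iff \<open>u \<cdot> m\<close>
  factors through \<open>n\<close>.\<close>

definition sub_total :: "('o, 'm) cat \<Rightarrow> ('m, 'm \<times> 'm \<times> 'm) cat" where
  "sub_total C =
     \<lparr>Obj = {m. monic C m},
      Mor = {(m, u, n). monic C m \<and> monic C n \<and> u \<in> Hom C (Cod C m) (Cod C n) \<and>
               (\<exists>v\<in>Hom C (Dom C m) (Dom C n). u \<cdot>\<^bsub>C\<^esub> m = n \<cdot>\<^bsub>C\<^esub> v)},
      Dom = (\<lambda>(m, u, n). m),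
      Cod = (\<lambda>(m, u, n). n),
      Idn = (\<lambda>m. (m, Idn C (Cod C m), m)),
      Comp = (\<lambda>(_, w, k) (m, u, _). (m, w \<cdot>\<^bsub>C\<^esub> u, k))\<rparr>"

definition sub :: "('o, 'm) cat \<Rightarrow> ('m, 'm \<times> 'm \<times> 'm, 'o, 'm) cfunctor" where
  "sub C = \<lparr>total = sub_total C, base = C, omap = Cod C, mmap = (\<lambda>(m, u, n). u)\<rparr>"

definition boolean_topos :: "('o, 'm) cat \<Rightarrow> bool" where
  "boolean_topos C \<longleftrightarrow> topos C \<and> (\<forall>A\<in>Obj C. boolean_prealgebra (fiber (sub C) A))"


section \<open>Triposes\<close>

definition has_universal_quantification :: "('x, 'f, 'o, 'm) cfunctor \<Rightarrow> bool" where
  "has_universal_quantification P \<longleftrightarrow>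
     (\<exists>all :: 'm \<Rightarrow> 'x \<Rightarrow> 'x.
        (\<forall>A B. \<forall>u\<in>Hom (base P) A B. adjunction (fiber P B) (fiber P A) (reindex P u) (all u)) \<and>
        (\<forall>f g p q. is_pullback (base P) f g p q \<longrightarrow>
           (\<forall>\<phi>\<in>carrier (fiber P (Dom (base P) f)).
              reindex P g (all f \<phi>) .=\<^bsub>fiber P (Dom (base P) g)\<^esub> all q (reindex P p \<phi>))))"

definition has_generic_predicate :: "('x, 'f, 'o, 'm) cfunctor \<Rightarrow> bool" where
  "has_generic_predicate P \<longleftrightarrow>
     (\<exists>Prop\<in>Obj (base P). \<exists>tr\<in>carrier (fiber P Prop).
        \<forall>A\<in>Obj (base P). \<forall>\<phi>\<in>carrier (fiber P A).
          \<exists>f\<in>Hom (base P) A Prop. \<phi> .=\<^bsub>fiber P A\<^esub> reindex P f tr)"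

definition tripos :: "('x, 'f, 'o, 'm) cfunctor \<Rightarrow> bool" where
  "tripos P \<longleftrightarrow> cartesian_closed (base P) \<and> preorder_fibration P \<and>
     (\<forall>A\<in>Obj (base P). heyting_prealgebra (fiber P A)) \<and>
     (\<forall>A B. \<forall>u\<in>Hom (base P) A B.
        preserves_heyting_structure (fiber P B) (fiber P A) (reindex P u)) \<and>
     has_universal_quantification P \<and> has_generic_predicate P"

definition regular_tripos :: "('x, 'f, 'o, 'm) cfunctor \<Rightarrow> bool" where
  "regular_tripos P \<longleftrightarrow> tripos P \<and>
     (\<forall>A B. \<forall>e\<in>Hom (base P) A B. epic (base P) e \<longrightarrow>
        (\<forall>\<phi>\<in>carrier (fiber P B). \<forall>\<psi>\<in>carrier (fiber P B).
           reindex P e \<phi> \<sqsubseteq>\<^bsub>fiber P A\<^esub> reindex P e \<psi> \<longrightarrow> \<phi> \<sqsubseteq>\<^bsub>fiber P B\<^esub> \<psi>))"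

text \<open>Existential quantification along \<open>u\<close>, the left adjoint of \<open>u\<^sup>*\<close>, is determined only up to
  equivalence; its existence in any tripos is a consequence of the axioms.\<close>

definition ex_along :: "('x, 'f, 'o, 'm) cfunctor \<Rightarrow> 'm \<Rightarrow> 'x \<Rightarrow> 'x" where
  "ex_along P u =
     (SOME E. adjunction (fiber P (Dom (base P) u)) (fiber P (Cod (base P) u)) E (reindex P u))"

definition delta :: "('x, 'f, 'o, 'm) cfunctor \<Rightarrow> 'm \<Rightarrow> 'x" where
  "delta P m = ex_along P m \<top>\<^bsub>fiber P (Dom (base P) m)\<^esub>"

definition totally_connected :: "('x, 'f, 'o, 'm) cfunctor \<Rightarrow> bool" where
  "totally_connected P \<longleftrightarrow> regular_tripos P \<and>
     (\<exists>\<pi>. fibered_left_adjoint P (sub (base P)) \<pi> (delta P) \<and>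
        (\<forall>A\<in>Obj (base P). preserves_finite_meets (fiber P A) (fiber (sub (base P)) A) \<pi>))"

end

theory Submission
  imports Defs
begin

text \<open>
  Since the subobject lattices are Boolean and \<open>\<pi>\<close> preserves finite meets, the claim is pure order
  theory once \<open>\<delta>\<bottom> \<le> \<bottom>\<close> and \<open>m \<le> \<pi>\<delta>m\<close> are known: the first gives \<open>\<delta>\<pi>\<phi> \<and> \<not>\<phi> \<le> \<bottom>\<close>, because its
  image under \<open>\<pi>\<close> lies below \<open>\<pi>(\<phi> \<and> \<not>\<phi>)\<close>, and the second gives \<open>\<not>\<pi>\<phi> \<le> \<pi>\<delta>\<not>\<pi>\<phi> \<le> \<pi>\<not>\<phi>\<close>, whence
  \<open>\<pi>\<not>\<not>\<phi> \<and> \<not>\<pi>\<phi> \<le> \<bottom>\<close>.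

  Any two parallel arrows out of the bottom subobject \<open>U\<close> of \<open>A\<close> agree, because their equalizer is
  again a subobject of \<open>A\<close>. As every predicate on \<open>U\<close> is a reindexing of the generic one, the fiber
  over \<open>U\<close> is trivial, so \<open>\<delta>\<bottom> \<le> \<bottom>\<close>. For \<open>m \<le> \<pi>\<delta>m\<close>, both \<open>\<delta>\<close> and \<open>\<pi>\<close> commute with reindexing and
  preserve \<open>\<top>\<close>, so \<open>m\<^sup>*\<pi>\<delta>m\<close> is equivalent to \<open>\<pi>\<delta>(m\<^sup>*m)\<close>, which is \<open>\<top>\<close>.
\<close>

section \<open>Heyting prealgebras\<close>

text \<open>The locale form of \<open>heyting_prealgebra\<close>, so that interpretation brings the
  weak lattice calculus to each fiber. As \<open>imp\<close> is a \<open>SOME\<close>, it is fixed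
  only up to equivalence.\<close>

locale heyting = weak_bounded_lattice +
  assumes imp_exists: "x \<in> carrier L \<Longrightarrow> y \<in> carrier L \<Longrightarrow> \<exists>z. is_imp L x y z"
begin

lemma is_imp_imp:
  assumes "x \<in> carrier L" "y \<in> carrier L"
  shows "is_imp L x y (imp L x y)"
  unfolding imp_def using someI_ex[OF imp_exists[OF assms]] .

lemma imp_closed [simp]: "x \<in> carrier L \<Longrightarrow> y \<in> carrier L \<Longrightarrow> imp L x y \<in> carrier L"
  using is_imp_imp by (simp add: is_imp_def)

lemma neg_closed [simp]: "x \<in> carrier L \<Longrightarrow> neg L x \<in> carrier L"
  by (simp add: neg_def)

lemma le_imp_iff:
  "\<lbrakk>w \<in> carrier L; x \<in> carrier L; y \<in> carrier L\<rbrakk> \<Longrightarrow> w \<sqsubseteq> imp L x y \<longleftrightarrow> w \<sqinter> x \<sqsubseteq> y"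
  using is_imp_imp by (simp add: is_imp_def)

lemma le_neg_iff: "\<lbrakk>w \<in> carrier L; x \<in> carrier L\<rbrakk> \<Longrightarrow> w \<sqsubseteq> neg L x \<longleftrightarrow> w \<sqinter> x \<sqsubseteq> \<bottom>"
  by (simp add: neg_def le_imp_iff)

lemma meet_mono:
  assumes "x \<sqsubseteq> x'" "y \<sqsubseteq> y'" "x \<in> carrier L" "x' \<in> carrier L" "y \<in> carrier L" "y' \<in> carrier L"
  shows "x \<sqinter> y \<sqsubseteq> x' \<sqinter> y'"
  using assms by (meson le_trans meet_closed meet_le meet_left meet_right)

lemma neg_meet_le_bottom: "x \<in> carrier L \<Longrightarrow> neg L x \<sqinter> x \<sqsubseteq> \<bottom>"
  using le_neg_iff[of "neg L x" x] by simp

lemma meet_neg_le_bottom: "x \<in> carrier L \<Longrightarrow> x \<sqinter> neg L x \<sqsubseteq> \<bottom>"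
  using neg_meet_le_bottom by (simp add: meet_comm)

end

lemma heyting_prealgebra_iff: "heyting_prealgebra L \<longleftrightarrow> heyting L"
  by (auto simp: heyting_prealgebra_def heyting_def heyting_axioms_def)

text \<open>Both \<open>x\<close> and \<open>neg L x\<close> lie below \<open>imp L z x\<close>, the
  latter because \<open>z\<close> is disjoint from \<open>neg L x\<close>. By excluded middle their
  join is the top, so \<open>z\<close> lies below \<open>imp L z x\<close> too, and hence below
  \<open>x\<close>.\<close>

lemma boolean_le_if_meet_neg_le_bottom:
  fixes L (structure)
  assumes bool: "boolean_prealgebra L" and x: "x \<in> carrier L" and z: "z \<in> carrier L"
    and zx: "z \<sqinter> neg L x \<sqsubseteq> \<bottom>"
  shows "z \<sqsubseteq> x"
proof -
  interpret heyting L
    using bool by (simp add: boolean_prealgebra_def heyting_prealgebra_iff)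
  have "neg L x \<sqinter> z \<sqsubseteq> x"
    using zx x z by (metis bottom_closed bottom_lower le_trans meet_closed meet_comm neg_closed)
  then have "neg L x \<sqsubseteq> imp L z x"
    using x z by (simp add: le_imp_iff)
  moreover have "x \<sqsubseteq> imp L z x"
    using x z by (simp add: le_imp_iff meet_left)
  ultimately have "x \<squnion> neg L x \<sqsubseteq> imp L z x"
    using x z by (simp add: join_le)
  moreover have "x \<squnion> neg L x .= \<top>"
    using bool x by (simp add: boolean_prealgebra_def)
  ultimately have "\<top> \<sqsubseteq> imp L z x"
    using x z by (meson imp_closed join_closed le_cong_l local.sym neg_closed top_closed)
  then have "z \<sqsubseteq> imp L z x"
    using x z by (meson imp_closed le_trans top_closed top_higher)
  then have "z \<sqinter> z \<sqsubseteq> x"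
    using x z by (simp add: le_imp_iff)
  then show ?thesis
    using x z by (meson le_refl le_trans meet_closed meet_le)
qed

text \<open>The order-theoretic core, to be applied with \<open>f\<close> as \<pi> and
  \<open>g\<close> as \<delta>. \<open>meet\<close> is the half of binary meet preservation that
  goes beyond monotonicity; \<open>counit\<close> is the reverse of the usual counit inequality and
  so makes the counit invertible.\<close>

lemma right_left_adjoint_eq_double_neg:
  fixes L :: "'a gorder" and M :: "'b gorder"
  assumes heyt: "heyting_prealgebra L" and bool: "boolean_prealgebra M"
    and adj: "adjunction L M f g"
    and meet: "\<And>x y. \<lbrakk>x \<in> carrier L; y \<in> carrier L\<rbrakk> \<Longrightarrow> f x \<sqinter>\<^bsub>M\<^esub> f y \<sqsubseteq>\<^bsub>M\<^esub> f (x \<sqinter>\<^bsub>L\<^esub> y)"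
    and bot: "g \<bottom>\<^bsub>M\<^esub> \<sqsubseteq>\<^bsub>L\<^esub> \<bottom>\<^bsub>L\<^esub>"
    and counit: "\<And>y. y \<in> carrier M \<Longrightarrow> y \<sqsubseteq>\<^bsub>M\<^esub> f (g y)"
    and x: "x \<in> carrier L"
  shows "g (f x) .=\<^bsub>L\<^esub> neg L (neg L x)"
proof -
  interpret L: heyting L
    using heyt by (simp add: heyting_prealgebra_iff)
  interpret M: heyting M
    using bool by (simp add: boolean_prealgebra_def heyting_prealgebra_iff)
  have f_closed [simp]: "f a \<in> carrier M" if "a \<in> carrier L" for a
    using adj that by (auto simp: adjunction_def)
  have g_closed [simp]: "g b \<in> carrier L" if "b \<in> carrier M" for b
    using adj that by (auto simp: adjunction_def)
  have adj_iff: "f a \<sqsubseteq>\<^bsub>M\<^esub> b \<longleftrightarrow> a \<sqsubseteq>\<^bsub>L\<^esub> g b" if "a \<in> carrier L" "b \<in> carrier M" for a b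
    using adj that by (auto simp: adjunction_def)
  have f_mono: "f a \<sqsubseteq>\<^bsub>M\<^esub> f b" if "a \<sqsubseteq>\<^bsub>L\<^esub> b" "a \<in> carrier L" "b \<in> carrier L" for a b
    using adj that by (auto simp: adjunction_def isotone_def)
  \<comment> \<open>By transposition and \<open>bot\<close>, \<open>f\<close> reflects the bottom;
    as a left adjoint it also preserves it. With \<open>meet\<close>, disjoint elements thus have
    disjoint images, which is \<open>disj\<close>.\<close>
  have le_bottomI: "a \<sqsubseteq>\<^bsub>L\<^esub> \<bottom>\<^bsub>L\<^esub>" if "f a \<sqsubseteq>\<^bsub>M\<^esub> \<bottom>\<^bsub>M\<^esub>" "a \<in> carrier L" for a
    using that bot adj_iff by (meson L.bottom_closed L.le_trans M.bottom_closed g_closed)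
  have f_le_bottom: "f a \<sqsubseteq>\<^bsub>M\<^esub> \<bottom>\<^bsub>M\<^esub>" if "a \<sqsubseteq>\<^bsub>L\<^esub> \<bottom>\<^bsub>L\<^esub>" "a \<in> carrier L" for a
    using that adj_iff by (meson L.bottom_closed L.bottom_lower L.le_trans M.bottom_closed g_closed)
  have disj: "f a \<sqinter>\<^bsub>M\<^esub> f b \<sqsubseteq>\<^bsub>M\<^esub> \<bottom>\<^bsub>M\<^esub>"
    if "a \<sqinter>\<^bsub>L\<^esub> b \<sqsubseteq>\<^bsub>L\<^esub> \<bottom>\<^bsub>L\<^esub>" "a \<in> carrier L" "b \<in> carrier L" for a b
    using that meet f_le_bottom
    by (meson L.meet_closed M.bottom_closed M.le_trans M.meet_closed f_closed)
  show ?thesis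
  proof (rule L.weak_le_antisym)
    have "f (g (f x) \<sqinter>\<^bsub>L\<^esub> neg L x) \<sqsubseteq>\<^bsub>M\<^esub> f (neg L x)"
      using x by (simp add: f_mono L.meet_right)
    moreover have "f (g (f x) \<sqinter>\<^bsub>L\<^esub> neg L x) \<sqsubseteq>\<^bsub>M\<^esub> f x"
      using x by (simp add: adj_iff L.meet_left)
    ultimately have "f (g (f x) \<sqinter>\<^bsub>L\<^esub> neg L x) \<sqsubseteq>\<^bsub>M\<^esub> f x \<sqinter>\<^bsub>M\<^esub> f (neg L x)"
      using x by (simp add: M.meet_le)
    also have "\<dots> \<sqsubseteq>\<^bsub>M\<^esub> \<bottom>\<^bsub>M\<^esub>"
      using x by (simp add: disj L.meet_neg_le_bottom)
    finally have "f (g (f x) \<sqinter>\<^bsub>L\<^esub> neg L x) \<sqsubseteq>\<^bsub>M\<^esub> \<bottom>\<^bsub>M\<^esub>"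
      using x by simp
    then show "g (f x) \<sqsubseteq>\<^bsub>L\<^esub> neg L (neg L x)"
      using x by (simp add: L.le_neg_iff le_bottomI)
  next
    let ?n = "neg M (f x)"
    \<comment> \<open>Since \<open>f\<close> reflects the bottom, \<open>g ?n\<close> is disjoint
      from \<open>x\<close> as soon as the image of their meet lies below both \<open>?n\<close> and
      \<open>f x\<close>.\<close>
    have "f (g ?n \<sqinter>\<^bsub>L\<^esub> x) \<sqsubseteq>\<^bsub>M\<^esub> ?n"
      using x by (simp add: adj_iff L.meet_left)
    moreover have "f (g ?n \<sqinter>\<^bsub>L\<^esub> x) \<sqsubseteq>\<^bsub>M\<^esub> f x"
      using x by (simp add: f_mono L.meet_right)
    ultimately have "f (g ?n \<sqinter>\<^bsub>L\<^esub> x) \<sqsubseteq>\<^bsub>M\<^esub> ?n \<sqinter>\<^bsub>M\<^esub> f x"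
      using x by (simp add: M.meet_le)
    also have "\<dots> \<sqsubseteq>\<^bsub>M\<^esub> \<bottom>\<^bsub>M\<^esub>"
      using x by (simp add: M.neg_meet_le_bottom)
    finally have "g ?n \<sqsubseteq>\<^bsub>L\<^esub> neg L x"
      using x by (simp add: L.le_neg_iff le_bottomI)
    then have "f (g ?n) \<sqsubseteq>\<^bsub>M\<^esub> f (neg L x)"
      using x by (simp add: f_mono)
    with counit[of ?n] have "?n \<sqsubseteq>\<^bsub>M\<^esub> f (neg L x)"
      using x by (meson M.le_trans M.neg_closed L.neg_closed f_closed g_closed)
    then have "f (neg L (neg L x)) \<sqinter>\<^bsub>M\<^esub> ?n \<sqsubseteq>\<^bsub>M\<^esub> f (neg L (neg L x)) \<sqinter>\<^bsub>M\<^esub> f (neg L x)"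
      using x by (simp add: M.meet_mono)
    also have "\<dots> \<sqsubseteq>\<^bsub>M\<^esub> \<bottom>\<^bsub>M\<^esub>"
      using x by (simp add: disj L.neg_meet_le_bottom)
    finally have "f (neg L (neg L x)) \<sqinter>\<^bsub>M\<^esub> ?n \<sqsubseteq>\<^bsub>M\<^esub> \<bottom>\<^bsub>M\<^esub>"
      using x by simp
    then have "f (neg L (neg L x)) \<sqsubseteq>\<^bsub>M\<^esub> f x"
      using x by (simp add: boolean_le_if_meet_neg_le_bottom[OF bool, of "f x"])
    then show "neg L (neg L x) \<sqsubseteq>\<^bsub>L\<^esub> g (f x)"
      using x by (simp add: adj_iff)
  qed (use x in simp_all)
qed

section \<open>Subobjects\<close>

context category
begin

lemma HomD:
  assumes "f \<in> Hom C A B"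
  shows "f \<in> Mor C" "Dom C f = A" "Cod C f = B" "A \<in> Obj C" "B \<in> Obj C"
  using assms Dom_Obj Cod_Obj by (auto simp: Hom_def)

lemma HomI: "f \<in> Mor C \<Longrightarrow> f \<in> Hom C (Dom C f) (Cod C f)"
  by (simp add: Hom_def)

lemma monicD:
  assumes "monic C m" "f \<in> Hom C X (Dom C m)" "g \<in> Hom C X (Dom C m)" "m \<cdot> f = m \<cdot> g"
  shows "f = g"
  using assms HomD(4) by (metis monic_def)

lemma monic_Hom: "monic C m \<Longrightarrow> m \<in> Hom C (Dom C m) (Cod C m)"
  by (simp add: monic_def Hom_def)

lemma monic_Idn: "A \<in> Obj C \<Longrightarrow> monic C (Idn C A)"
  using Idn_Hom[of A] HomD[OF Idn_Hom[of A]] Idn_left by (auto simp: monic_def)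

text \<open>Arrows identified by \<open>p\<close> are identified by \<open>n \<cdot> q\<close>,
  hence by \<open>q\<close> because \<open>n\<close> is monic; uniqueness of mediating arrows then
  makes them equal.\<close>

lemma pullback_monic:
  assumes pb: "is_pullback C u n p q" and n: "monic C n"
  shows "monic C p"
proof -
  have p: "p \<in> Hom C (Dom C p) (Dom C u)" and q: "q \<in> Hom C (Dom C p) (Dom C n)"
    and sq: "u \<cdot> p = n \<cdot> q" and u: "u \<in> Hom C (Dom C u) (Cod C n)"
    and uniq: "\<And>X a b. \<lbrakk>a \<in> Hom C X (Dom C u); b \<in> Hom C X (Dom C n); u \<cdot> a = n \<cdot> b\<rbrakk>
      \<Longrightarrow> \<exists>!h. h \<in> Hom C X (Dom C p) \<and> p \<cdot> h = a \<and> q \<cdot> h = b"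
    using pb HomD(4) unfolding is_pullback_def by (auto intro: HomI simp: Hom_def)
  note n' = monic_Hom[OF n]
  show ?thesis
    unfolding monic_def
  proof (intro conjI ballI impI)
    show "p \<in> Mor C" using p by (rule HomD)
    fix X f g
    assume f: "f \<in> Hom C X (Dom C p)" and g: "g \<in> Hom C X (Dom C p)" and eq: "p \<cdot> f = p \<cdot> g"
    have "n \<cdot> (q \<cdot> f) = u \<cdot> (p \<cdot> f)"
      by (simp add: Comp_assoc[OF f q n'] Comp_assoc[OF f p u] sq)
    moreover have "n \<cdot> (q \<cdot> g) = u \<cdot> (p \<cdot> g)"
      by (simp add: Comp_assoc[OF g q n'] Comp_assoc[OF g p u] sq)
    ultimately have qq: "q \<cdot> f = q \<cdot> g"
      using monicD[OF n Comp_Hom[OF f q] Comp_Hom[OF g q]] eq by simp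
    have "u \<cdot> (p \<cdot> f) = n \<cdot> (q \<cdot> f)"
      by (simp add: Comp_assoc[OF f q n'] Comp_assoc[OF f p u] sq)
    from uniq[OF Comp_Hom[OF f p] Comp_Hom[OF f q] this] f g eq qq
    show "f = g" by metis
  qed
qed

lemma monic_comp:
  assumes m: "monic C m" and e: "monic C e" and "Cod C e = Dom C m"
  shows "monic C (m \<cdot> e)"
proof -
  note m' = monic_Hom[OF m]
  have e': "e \<in> Hom C (Dom C e) (Dom C m)" using monic_Hom[OF e] assms(3) by simp
  note me = Comp_Hom[OF e' m']
  show ?thesis
    unfolding monic_def HomD[OF me]
  proof (intro conjI ballI impI)
    fix X f g
    assume f: "f \<in> Hom C X (Dom C e)" and g: "g \<in> Hom C X (Dom C e)"
      and eq: "(m \<cdot> e) \<cdot> f = (m \<cdot> e) \<cdot> g"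
    have "m \<cdot> (e \<cdot> f) = m \<cdot> (e \<cdot> g)"
      by (simp add: Comp_assoc[OF f e' m'] Comp_assoc[OF g e' m'] eq)
    then have "e \<cdot> f = e \<cdot> g"
      by (rule monicD[OF m Comp_Hom[OF f e'] Comp_Hom[OF g e']])
    then show "f = g" by (rule monicD[OF e f g])
  qed (use HomD[OF me] in simp)
qed

end

text \<open>Pull back the diagonal \<open>d\<close> of \<open>B\<close> along the pairing
  \<open>h\<close> of \<open>f\<close> and \<open>g\<close>. A projection splits the diagonal, so it
  is monic, and so is its pullback \<open>e\<close>; both composites with \<open>e\<close> equal the
  other leg \<open>k\<close>.\<close>

lemma equalizer_exists:
  assumes "topos E" "f \<in> Hom E U B" "g \<in> Hom E U B"
  obtains e where "monic E e" "Cod E e = U" "f \<cdot>\<^bsub>E\<^esub> e = g \<cdot>\<^bsub>E\<^esub> e"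
proof -
  interpret category E
    using assms(1) by (simp add: topos_def cartesian_closed_def)
  note f = assms(2) and g = assms(3)
  have U: "U \<in> Obj E" and B: "B \<in> Obj E" using HomD[OF f] by auto
  obtain Q p q where prod: "is_product E B B Q p q"
    using assms(1) B unfolding topos_def cartesian_closed_def by meson
  have p: "p \<in> Hom E Q B" and q: "q \<in> Hom E Q B"
    using prod by (auto simp: is_product_def)
  obtain d where d: "d \<in> Hom E B Q" "p \<cdot>\<^bsub>E\<^esub> d = Idn E B" "q \<cdot>\<^bsub>E\<^esub> d = Idn E B"
    using prod B Idn_Hom[OF B] unfolding is_product_def by meson
  obtain h where h: "h \<in> Hom E U Q" "p \<cdot>\<^bsub>E\<^esub> h = f" "q \<cdot>\<^bsub>E\<^esub> h = g"
    using prod U f g unfolding is_product_def by meson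
  have d_monic: "monic E d"
    unfolding monic_def
  proof (intro conjI ballI impI)
    show "d \<in> Mor E" using d(1) by (rule HomD)
    fix X a b
    assume "a \<in> Hom E X (Dom E d)" "b \<in> Hom E X (Dom E d)" and eq: "d \<cdot>\<^bsub>E\<^esub> a = d \<cdot>\<^bsub>E\<^esub> b"
    then have a: "a \<in> Hom E X B" and b: "b \<in> Hom E X B" using HomD[OF d(1)] by auto
    have "p \<cdot>\<^bsub>E\<^esub> (d \<cdot>\<^bsub>E\<^esub> a) = a" "p \<cdot>\<^bsub>E\<^esub> (d \<cdot>\<^bsub>E\<^esub> b) = b"
      by (simp_all only: Comp_assoc[OF a d(1) p] Comp_assoc[OF b d(1) p] d(2)
          Idn_left[OF a] Idn_left[OF b])
    with eq show "a = b" by metis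
  qed
  obtain e k where pb: "is_pullback E h d e k"
    using assms(1) HomD[OF h(1)] HomD[OF d(1)] by (metis topos_def has_pullbacks_def)
  then have e: "e \<in> Hom E (Dom E e) U" and k: "k \<in> Hom E (Dom E e) B"
    and sq: "h \<cdot>\<^bsub>E\<^esub> e = d \<cdot>\<^bsub>E\<^esub> k"
    using HomD[OF h(1)] HomD[OF d(1)] by (auto simp: is_pullback_def)
  have "f \<cdot>\<^bsub>E\<^esub> e = k" "g \<cdot>\<^bsub>E\<^esub> e = k"
    using Comp_assoc[OF e h(1) p] Comp_assoc[OF k d(1) p] Comp_assoc[OF e h(1) q]
      Comp_assoc[OF k d(1) q] sq h d Idn_left[OF k] by simp_all
  then show thesis
    using that[of e] pullback_monic[OF pb d_monic] HomD[OF e] by simp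
qed

section \<open>The subobject fibration: order, cartesian liftings and reindexing\<close>

lemma sub_sel [simp]:
  "total (sub C) = sub_total C" "base (sub C) = C" "omap (sub C) = Cod C"
  "mmap (sub C) (m, u, n) = u"
  "Obj (sub_total C) = {m. monic C m}"
  "Dom (sub_total C) (m, u, n) = m" "Cod (sub_total C) (m, u, n) = n"
  "Comp (sub_total C) (m', w, k) (m, u, n') = (m, w \<cdot>\<^bsub>C\<^esub> u, k)"
  by (simp_all add: sub_def sub_total_def)

lemma Mor_sub_total:
  "(m, u, n) \<in> Mor (sub_total C) \<longleftrightarrow> monic C m \<and> monic C n \<and> u \<in> Hom C (Cod C m) (Cod C n) \<and>
     (\<exists>v\<in>Hom C (Dom C m) (Dom C n). u \<cdot>\<^bsub>C\<^esub> m = n \<cdot>\<^bsub>C\<^esub> v)"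
  by (simp add: sub_total_def)

lemma Hom_sub_total: "f \<in> Hom (sub_total C) m n \<longleftrightarrow> f \<in> Mor (sub_total C) \<and> (\<exists>u. f = (m, u, n))"
  by (cases f) (auto simp: Hom_def)

lemma carrier_fiber_sub [simp]: "m \<in> carrier (fiber (sub C) A) \<longleftrightarrow> monic C m \<and> Cod C m = A"
  by (simp add: fiber_def)

context category
begin

lemma le_fiber_sub:
  assumes "monic C m" "Cod C m = A" "monic C n" "Cod C n = A"
  shows "m \<sqsubseteq>\<^bsub>fiber (sub C) A\<^esub> n \<longleftrightarrow> (\<exists>v\<in>Hom C (Dom C m) (Dom C n). m = n \<cdot> v)"
proof -
  have "A \<in> Obj C" using assms(2) HomD[OF monic_Hom[OF assms(1)]] by simp
  moreover have "Idn C A \<cdot> m = m" using Idn_left monic_Hom assms(1,2) by blast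
  ultimately show ?thesis
    using assms Idn_Hom by (auto simp: fiber_def vle_def Bex_def Hom_sub_total Mor_sub_total)
qed

text \<open>The pullback of \<open>n\<close> along \<open>u\<close> supplies the lifting.
  Cartesianness uses the existence of mediating arrows; uniqueness is automatic, as an arrow of
  \<open>sub_total\<close> is determined by its endpoints and its base arrow.\<close>

lemma cartesian_lift_sub_exists:
  assumes pbs: "has_pullbacks C" and n: "monic C n" and u: "u \<in> Hom C A (Cod C n)"
  shows "\<exists>f. cartesian_lift (sub C) u n f"
proof -
  note n' = monic_Hom[OF n]
  obtain p q where pb: "is_pullback C u n p q"
    using pbs HomD[OF u] HomD[OF n'] by (metis has_pullbacks_def)
  note p_monic = pullback_monic[OF pb n]
  have p: "p \<in> Hom C (Dom C p) A" and q: "q \<in> Hom C (Dom C p) (Dom C n)" and sq: "u \<cdot> p = n \<cdot> q"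
    and univ: "\<And>X a b. \<lbrakk>a \<in> Hom C X A; b \<in> Hom C X (Dom C n); u \<cdot> a = n \<cdot> b\<rbrakk>
      \<Longrightarrow> \<exists>h. h \<in> Hom C X (Dom C p) \<and> p \<cdot> h = a"
    using pb HomD[OF u] HomD(4) unfolding is_pullback_def by blast+
  have mor: "(p, u, n) \<in> Mor (sub_total C)"
    using p_monic n u q sq HomD[OF p] by (auto simp: Mor_sub_total)
  have "is_cartesian (sub C) (p, u, n)"
    unfolding is_cartesian_def
  proof (intro conjI ballI impI)
    fix z g w
    assume g: "g \<in> Hom (total (sub C)) z (Cod (total (sub C)) (p, u, n))"
      and w: "w \<in> Hom (base (sub C)) (omap (sub C) z) (omap (sub C) (Dom (total (sub C)) (p, u, n)))"
      and eq: "mmap (sub C) g = mmap (sub C) (p, u, n) \<cdot>\<^bsub>base (sub C)\<^esub> w"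
    have w: "w \<in> Hom C (Cod C z) A" using w HomD[OF p] by simp
    have g_eq: "g = (z, u \<cdot> w, n)" using g eq by (auto simp: Hom_sub_total)
    have z: "monic C z" and "\<exists>v\<in>Hom C (Dom C z) (Dom C n). (u \<cdot> w) \<cdot> z = n \<cdot> v"
      using g unfolding g_eq by (simp_all add: Hom_sub_total Mor_sub_total)
    then obtain v where v: "v \<in> Hom C (Dom C z) (Dom C n)" "(u \<cdot> w) \<cdot> z = n \<cdot> v" by blast
    note z' = monic_Hom[OF z]
    \<comment> \<open>The arrows \<open>w \<cdot> z\<close> and \<open>v\<close> form a cone over
      the pullback. The mediating \<open>h\<close> is the factorization through \<open>p\<close>
      that makes \<open>(z, w, p)\<close> an arrow.\<close>
    obtain h where "h \<in> Hom C (Dom C z) (Dom C p)" "p \<cdot> h = w \<cdot> z"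
      using univ[OF Comp_Hom[OF z' w] v(1)] v(2) Comp_assoc[OF z' w u] by auto
    then have "(z, w, p) \<in> Hom (sub_total C) z p"
      using z p_monic w HomD(3)[OF p] by (metis Hom_sub_total Mor_sub_total)
    then show "\<exists>!h. h \<in> Hom (total (sub C)) z (Dom (total (sub C)) (p, u, n)) \<and>
        mmap (sub C) h = w \<and> (p, u, n) \<cdot>\<^bsub>total (sub C)\<^esub> h = g"
      by (intro ex1I[of _ "(z, w, p)"]) (auto simp: g_eq Hom_sub_total)
  qed (use mor in simp)
  then show ?thesis
    by (auto simp: cartesian_lift_def)
qed

text \<open>An arrow of \<open>sub_total\<close> records its endpoints and base arrow, so the
  lifting picked by \<open>SOME\<close> is known once its domain is; every later fact about
  \<open>reindex\<close> on subobjects is read off from this triple.\<close>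

lemma reindex_sub_lift:
  assumes "has_pullbacks C" "monic C n" "u \<in> Hom C A (Cod C n)"
  shows "cartesian_lift (sub C) u n (reindex (sub C) u n, u, n)"
proof -
  have lift: "cartesian_lift (sub C) u n (SOME f. cartesian_lift (sub C) u n f)" (is "cartesian_lift _ _ _ ?f")
    using someI_ex[OF cartesian_lift_sub_exists[OF assms]] .
  then have "?f = (reindex (sub C) u n, u, n)"
    unfolding reindex_def by (cases ?f) (metis cartesian_lift_def sub_sel(1,4,6,7))
  with lift show ?thesis by simp
qed

lemma reindex_sub_closed:
  assumes "has_pullbacks C" "monic C n" "u \<in> Hom C A (Cod C n)"
  shows "monic C (reindex (sub C) u n)" "Cod C (reindex (sub C) u n) = A"
  using reindex_sub_lift[OF assms] HomD[OF assms(3)] HomD(2)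
  by (auto simp: cartesian_lift_def is_cartesian_def Mor_sub_total)

text \<open>The triple of the identity, \<open>m\<close> and \<open>m\<close> is an arrow over
  \<open>m\<close>, and cartesianness factors it vertically through the chosen lifting. The identity
  serves as a concrete greatest subobject.\<close>

lemma le_reindex_sub_self:
  assumes pbs: "has_pullbacks C" and m: "monic C m"
  shows "Idn C (Dom C m) \<sqsubseteq>\<^bsub>fiber (sub C) (Dom C m)\<^esub> reindex (sub C) m m"
proof -
  let ?l = "reindex (sub C) m m" and ?i = "Idn C (Dom C m)"
  note m' = monic_Hom[OF m]
  have D: "Dom C m \<in> Obj C" using HomD[OF m'] by simp
  note i = Idn_Hom[OF D] and i_monic = monic_Idn[OF D]
  note l = reindex_sub_closed[OF pbs m m']
  have "(?i, m, m) \<in> Hom (sub_total C) ?i m"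
    using m i_monic HomD[OF i] m' i by (auto simp: Hom_sub_total Mor_sub_total)
  moreover have "m = m \<cdot> ?i" using Idn_right[OF m'] by simp
  ultimately obtain h where "h \<in> Hom (sub_total C) ?i ?l" "mmap (sub C) h = ?i"
    using reindex_sub_lift[OF pbs m m'] i_monic HomD[OF i] i l
    unfolding cartesian_lift_def is_cartesian_def by fastforce
  then show ?thesis
    by (auto simp: fiber_def vle_def)
qed

text \<open>The hypothesis gives a right inverse \<open>v\<close> of \<open>?l\<close>; composing it
  with the square \<open>m \<cdot> ?l = n \<cdot> w\<close> factors \<open>m\<close> through
  \<open>n\<close>. This permits an inequality to be tested after pulling back along
  \<open>m\<close>.\<close>

lemma le_if_le_reindex_sub:
  assumes pbs: "has_pullbacks C" and m: "monic C m" and n: "monic C n" and cod: "Cod C m = Cod C n"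
    and le: "Idn C (Dom C m) \<sqsubseteq>\<^bsub>fiber (sub C) (Dom C m)\<^esub> reindex (sub C) m n"
  shows "m \<sqsubseteq>\<^bsub>fiber (sub C) (Cod C m)\<^esub> n"
proof -
  let ?l = "reindex (sub C) m n" and ?i = "Idn C (Dom C m)"
  have m': "m \<in> Hom C (Dom C m) (Cod C n)" using monic_Hom[OF m] cod by simp
  note n' = monic_Hom[OF n]
  have D: "Dom C m \<in> Obj C" using HomD[OF m'] by simp
  note i = Idn_Hom[OF D]
  note l = reindex_sub_closed[OF pbs n m']
  have l': "?l \<in> Hom C (Dom C ?l) (Dom C m)" using monic_Hom[OF l(1)] l(2) by simp
  obtain v where v: "v \<in> Hom C (Dom C m) (Dom C ?l)" "?i = ?l \<cdot> v"
    using le le_fiber_sub[of ?i "Dom C m" ?l] monic_Idn[OF D] HomD[OF i] l by auto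
  obtain w where w: "w \<in> Hom C (Dom C ?l) (Dom C n)" "m \<cdot> ?l = n \<cdot> w"
    using reindex_sub_lift[OF pbs n m']
    by (auto simp: cartesian_lift_def is_cartesian_def Mor_sub_total)
  have "m = m \<cdot> (?l \<cdot> v)" using Idn_right[OF m'] v(2) by simp
  also have "\<dots> = n \<cdot> (w \<cdot> v)"
    using Comp_assoc[OF v(1) l' m'] Comp_assoc[OF v(1) w(1) n'] w(2) by simp
  finally show ?thesis
    using le_fiber_sub[OF m _ n] cod Comp_Hom[OF v(1) w(1)] by auto
qed

end

text \<open>Leastness puts \<open>m\<close> below \<open>m \<cdot> e\<close>, where \<open>e\<close>
  equalizes \<open>f\<close> and \<open>g\<close>. Cancelling \<open>m\<close> yields a right
  inverse of \<open>e\<close>, which forces \<open>f = g\<close>.\<close>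

lemma parallel_eq_on_bottom_subobject:
  assumes E: "topos E" and m: "monic E m"
    and least: "\<And>n. \<lbrakk>monic E n; Cod E n = Cod E m\<rbrakk> \<Longrightarrow> m \<sqsubseteq>\<^bsub>fiber (sub E) (Cod E m)\<^esub> n"
    and f: "f \<in> Hom E (Dom E m) B" and g: "g \<in> Hom E (Dom E m) B"
  shows "f = g"
proof -
  interpret category E
    using E by (simp add: topos_def cartesian_closed_def)
  note m' = monic_Hom[OF m]
  obtain e where e: "monic E e" "Cod E e = Dom E m" "f \<cdot>\<^bsub>E\<^esub> e = g \<cdot>\<^bsub>E\<^esub> e"
    using equalizer_exists[OF E f g] by blast
  have e': "e \<in> Hom E (Dom E e) (Dom E m)" using monic_Hom[OF e(1)] e(2) by simp
  note me = monic_comp[OF m e(1,2)] and me' = HomD[OF Comp_Hom[OF e' m']]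
  obtain v where v: "v \<in> Hom E (Dom E m) (Dom E e)" "m = (m \<cdot>\<^bsub>E\<^esub> e) \<cdot>\<^bsub>E\<^esub> v"
    using least[OF me me'(3)] le_fiber_sub[OF m refl me me'(3)] me'(2) by auto
  have "m \<cdot>\<^bsub>E\<^esub> (e \<cdot>\<^bsub>E\<^esub> v) = m \<cdot>\<^bsub>E\<^esub> Idn E (Dom E m)"
    using Comp_assoc[OF v(1) e' m'] v(2) Idn_right[OF m'] by simp
  then have ev: "e \<cdot>\<^bsub>E\<^esub> v = Idn E (Dom E m)"
    by (rule monicD[OF m Comp_Hom[OF v(1) e'] Idn_Hom[OF HomD(4)[OF m']]])
  have "f = (f \<cdot>\<^bsub>E\<^esub> e) \<cdot>\<^bsub>E\<^esub> v" using Comp_assoc[OF v(1) e' f] ev Idn_right[OF f] by simp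
  also have "\<dots> = g" using e(3) Comp_assoc[OF v(1) e' g] ev Idn_right[OF g] by simp
  finally show ?thesis .
qed

section \<open>Totally connected triposes\<close>

lemma tripos_reindex_isotone:
  assumes "tripos P" "u \<in> Hom (base P) A B"
  shows "reindex P u \<in> carrier (fiber P B) \<rightarrow> carrier (fiber P A)"
    and "isotone (fiber P B) (fiber P A) (reindex P u)"
  \<comment> \<open>Reindexing along \<open>u\<close> is the left adjoint in the adjunction that
    defines universal quantification, which includes closure and monotonicity.\<close>
  using assms unfolding tripos_def has_universal_quantification_def adjunction_def by meson+

text \<open>Both predicates are reindexings of the generic predicate along arrows out of
  \<open>U\<close> with the same codomain, and these arrows coincide.\<close>

lemma tripos_fiber_trivial:
  assumes P: "tripos P" and U: "U \<in> Obj (base P)"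
    and parallel: "\<And>B f g. \<lbrakk>f \<in> Hom (base P) U B; g \<in> Hom (base P) U B\<rbrakk> \<Longrightarrow> f = g"
    and x: "x \<in> carrier (fiber P U)" and y: "y \<in> carrier (fiber P U)"
  shows "x \<sqsubseteq>\<^bsub>fiber P U\<^esub> y"
proof -
  interpret heyting "fiber P U"
    using P U by (simp add: tripos_def flip: heyting_prealgebra_iff)
  obtain B t where t: "t \<in> carrier (fiber P B)"
    and gen: "\<And>z. z \<in> carrier (fiber P U) \<Longrightarrow>
      \<exists>f\<in>Hom (base P) U B. z .=\<^bsub>fiber P U\<^esub> reindex P f t"
    using P U unfolding tripos_def has_generic_predicate_def by blast
  obtain f where f: "f \<in> Hom (base P) U B"
    and "x .=\<^bsub>fiber P U\<^esub> reindex P f t" "y .=\<^bsub>fiber P U\<^esub> reindex P f t"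
    using gen[OF x] gen[OF y] parallel by metis
  moreover have "reindex P f t \<in> carrier (fiber P U)"
    using tripos_reindex_isotone(1)[OF P f] t by auto
  ultimately show ?thesis
    using x y by (meson local.sym local.trans weak_refl)
qed

text \<open>Transposing along \<open>ex_along P m\<close> reduces the claim to an inequality with
  \<open>reindex P m y\<close> in the fiber over the domain of \<open>m\<close>, where any two
  predicates are equivalent.\<close>

lemma delta_bottom_le:
  assumes P: "tripos P" and E: "topos (base P)" and m: "monic (base P) m"
    and least: "\<And>n. \<lbrakk>monic (base P) n; Cod (base P) n = Cod (base P) m\<rbrakk>
      \<Longrightarrow> m \<sqsubseteq>\<^bsub>fiber (sub (base P)) (Cod (base P) m)\<^esub> n"
    and y: "y \<in> carrier (fiber P (Cod (base P) m))"
  shows "delta P m \<sqsubseteq>\<^bsub>fiber P (Cod (base P) m)\<^esub> y"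
proof -
  let ?U = "Dom (base P) m" and ?A = "Cod (base P) m"
  interpret category "base P"
    using E by (simp add: topos_def cartesian_closed_def)
  note m' = monic_Hom[OF m]
  note UA = HomD(4,5)[OF m']
  interpret U: heyting "fiber P ?U"
    using P UA by (simp add: tripos_def flip: heyting_prealgebra_iff)
  interpret A: heyting "fiber P ?A"
    using P UA by (simp add: tripos_def flip: heyting_prealgebra_iff)
  note re = tripos_reindex_isotone[OF P m']
  have triv: "x \<sqsubseteq>\<^bsub>fiber P ?U\<^esub> z" if "x \<in> carrier (fiber P ?U)" "z \<in> carrier (fiber P ?U)" for x z
    using tripos_fiber_trivial[OF P UA(1) _ that] parallel_eq_on_bottom_subobject[OF E m least]
    by blast
  have re_closed: "reindex P m z \<in> carrier (fiber P ?U)" if "z \<in> carrier (fiber P ?A)" for z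
    using re(1) that by auto
  \<comment> \<open>\<open>ex_along\<close> is a \<open>SOME\<close>: a left adjoint must be exhibited. Here the trivial fiber makes it constant.\<close>
  have "adjunction (fiber P ?U) (fiber P ?A) (\<lambda>_. \<bottom>\<^bsub>fiber P ?A\<^esub>) (reindex P m)"
    using re re_closed triv U.weak_partial_order_axioms A.weak_partial_order_axioms
    by (auto simp: adjunction_def isotone_def)
  then have "adjunction (fiber P ?U) (fiber P ?A) (ex_along P m) (reindex P m)"
    unfolding ex_along_def by (rule someI[of "\<lambda>E. adjunction _ _ E _"])
  moreover have "\<top>\<^bsub>fiber P ?U\<^esub> \<sqsubseteq>\<^bsub>fiber P ?U\<^esub> reindex P m y"
    using triv re_closed y by simp
  ultimately show ?thesis
    using y by (auto simp: delta_def adjunction_def)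
qed

section \<open>Invertibility of the counit\<close>

lemma fibered_mapD:
  assumes "fibered_map P Q F"
  shows "\<And>A x. \<lbrakk>A \<in> Obj (base P); x \<in> carrier (fiber P A)\<rbrakk> \<Longrightarrow> F x \<in> carrier (fiber Q A)"
    and "\<And>A x y. \<lbrakk>A \<in> Obj (base P); x \<in> carrier (fiber P A); y \<in> carrier (fiber P A);
      x \<sqsubseteq>\<^bsub>fiber P A\<^esub> y\<rbrakk> \<Longrightarrow> F x \<sqsubseteq>\<^bsub>fiber Q A\<^esub> F y"
    and "\<And>A B u y. \<lbrakk>u \<in> Hom (base P) A B; y \<in> carrier (fiber P B)\<rbrakk> \<Longrightarrow>
      F (reindex P u y) .=\<^bsub>fiber Q A\<^esub> reindex Q u (F y)"
  using assms by (auto simp: fibered_map_def isotone_def)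

text \<open>By \<open>le_if_le_reindex_sub\<close> it suffices that the identity lies below the
  pullback of \<open>\<pi> (delta P m)\<close> along \<open>m\<close>. \<open>top\<close> is the
  nullary part of meet preservation.\<close>

lemma left_adjoint_delta_counit:
  assumes P: "tripos P" and E: "boolean_topos (base P)"
    and adj: "fibered_left_adjoint P (sub (base P)) \<pi> (delta P)"
    and top: "\<And>A. A \<in> Obj (base P) \<Longrightarrow>
      \<top>\<^bsub>fiber (sub (base P)) A\<^esub> \<sqsubseteq>\<^bsub>fiber (sub (base P)) A\<^esub> \<pi> \<top>\<^bsub>fiber P A\<^esub>"
    and m: "monic (base P) m"
  shows "m \<sqsubseteq>\<^bsub>fiber (sub (base P)) (Cod (base P) m)\<^esub> \<pi> (delta P m)"
proof -
  let ?C = "base P" and ?U = "Dom (base P) m" and ?A = "Cod (base P) m"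
  let ?S = "sub (base P)"
  have tp: "topos ?C" and pbs: "has_pullbacks ?C"
    using E by (auto simp: boolean_topos_def topos_def)
  interpret category ?C
    using tp by (simp add: topos_def cartesian_closed_def)
  note m' = monic_Hom[OF m]
  note UA = HomD(4,5)[OF m']
  interpret U: heyting "fiber P ?U"
    using P UA by (simp add: tripos_def flip: heyting_prealgebra_iff)
  interpret SU: heyting "fiber ?S ?U"
    using E UA by (simp add: boolean_topos_def boolean_prealgebra_def flip: heyting_prealgebra_iff)
  have \<pi>: "fibered_map P ?S \<pi>" and \<delta>: "fibered_map ?S P (delta P)"
    and adjU: "adjunction (fiber P ?U) (fiber ?S ?U) \<pi> (delta P)"
    using adj UA by (auto simp: fibered_left_adjoint_def)
  note \<delta>_closed = fibered_mapD(1)[OF \<delta>, unfolded sub_sel] and \<pi>_closed = fibered_mapD(1)[OF \<pi>]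
  note re = tripos_reindex_isotone[OF P m']
  have i_closed: "Idn ?C ?U \<in> carrier (fiber ?S ?U)"
    using monic_Idn[OF UA(1)] HomD(3)[OF Idn_Hom[OF UA(1)]] by simp
  have m_closed: "m \<in> carrier (fiber ?S ?A)" using m by simp
  have mm_closed: "reindex ?S m m \<in> carrier (fiber ?S ?U)"
    using reindex_sub_closed[OF pbs m m'] by simp
  have dm_closed: "delta P m \<in> carrier (fiber P ?A)"
    using \<delta>_closed[OF UA(2) m_closed] .
  have pdm_closed: "\<pi> (delta P m) \<in> carrier (fiber ?S ?A)"
    using \<pi>_closed[OF UA(2) dm_closed] .
  have rdm_closed: "reindex P m (delta P m) \<in> carrier (fiber P ?U)"
    using re(1) dm_closed by auto
  \<comment> \<open>The top of a fiber is a choice among equivalent greatest elements; the identity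
    is shown to be greatest as well.\<close>
  have le_top_i: "x \<sqsubseteq>\<^bsub>fiber ?S ?U\<^esub> Idn ?C ?U" if "x \<in> carrier (fiber ?S ?U)" for x
    using that i_closed le_fiber_sub[of x ?U "Idn ?C ?U"] monic_Hom[of x] HomD(2)[OF Idn_Hom[OF UA(1)]]
      Idn_left by (auto intro!: bexI[of _ x])
  \<comment> \<open>This inequality is transposed to show that \<delta> sends the pullback of
    \<open>m\<close> along itself to the top predicate, and \<delta> commutes with that
    pullback.\<close>
  have "\<pi> \<top>\<^bsub>fiber P ?U\<^esub> \<sqsubseteq>\<^bsub>fiber ?S ?U\<^esub> reindex ?S m m"
    using SU.le_trans[OF le_top_i le_reindex_sub_self[OF pbs m]] \<pi>_closed[OF UA(1)] i_closed mm_closed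
    by simp
  then have "\<top>\<^bsub>fiber P ?U\<^esub> \<sqsubseteq>\<^bsub>fiber P ?U\<^esub> delta P (reindex ?S m m)"
    using adjU mm_closed by (auto simp: adjunction_def)
  moreover have "delta P (reindex ?S m m) .=\<^bsub>fiber P ?U\<^esub> reindex P m (delta P m)"
    using fibered_mapD(3)[OF \<delta>, of m ?U ?A m] m' m_closed by simp
  ultimately have "\<top>\<^bsub>fiber P ?U\<^esub> \<sqsubseteq>\<^bsub>fiber P ?U\<^esub> reindex P m (delta P m)"
    using U.le_cong_r[OF _ _ U.top_closed \<delta>_closed[OF UA(1) mm_closed] rdm_closed] by blast
  then have "\<pi> \<top>\<^bsub>fiber P ?U\<^esub> \<sqsubseteq>\<^bsub>fiber ?S ?U\<^esub> \<pi> (reindex P m (delta P m))"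
    using fibered_mapD(2)[OF \<pi> UA(1)] rdm_closed by simp
  moreover have "\<pi> (reindex P m (delta P m)) .=\<^bsub>fiber ?S ?U\<^esub> reindex ?S m (\<pi> (delta P m))"
    using fibered_mapD(3)[OF \<pi> m' dm_closed] .
  moreover have rpdm_closed: "reindex ?S m (\<pi> (delta P m)) \<in> carrier (fiber ?S ?U)"
    using reindex_sub_closed[OF pbs, of "\<pi> (delta P m)" m ?U] pdm_closed m' by simp
  ultimately have "\<pi> \<top>\<^bsub>fiber P ?U\<^esub> \<sqsubseteq>\<^bsub>fiber ?S ?U\<^esub> reindex ?S m (\<pi> (delta P m))"
    by (rule SU.le_cong_r[OF _ _ \<pi>_closed[OF UA(1) U.top_closed] \<pi>_closed[OF UA(1) rdm_closed]])
  moreover have "Idn ?C ?U \<sqsubseteq>\<^bsub>fiber ?S ?U\<^esub> \<pi> \<top>\<^bsub>fiber P ?U\<^esub>"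
    using SU.le_trans[OF SU.top_higher[OF i_closed] top[OF UA(1)] i_closed SU.top_closed]
      \<pi>_closed[OF UA(1) U.top_closed] by blast
  ultimately have "Idn ?C ?U \<sqsubseteq>\<^bsub>fiber ?S ?U\<^esub> reindex ?S m (\<pi> (delta P m))"
    using SU.le_trans[OF _ _ i_closed \<pi>_closed[OF UA(1) U.top_closed] rpdm_closed] by blast
  then show ?thesis
    using le_if_le_reindex_sub[OF pbs m] pdm_closed by (metis carrier_fiber_sub)
qed

text \<open>Total connectedness only provides some meet preserving left adjoint, not \<open>\<pi>\<close> itself.\<close>

lemma left_adjoint_preserves_finite_meets:
  assumes L: "weak_bounded_lattice L" and M: "weak_bounded_lattice M"
    and f: "adjunction L M f g" and f': "adjunction L M f' g"
    and pres: "preserves_finite_meets L M f'"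
  shows "\<top>\<^bsub>M\<^esub> \<sqsubseteq>\<^bsub>M\<^esub> f \<top>\<^bsub>L\<^esub>"
    and "\<lbrakk>x \<in> carrier L; y \<in> carrier L\<rbrakk> \<Longrightarrow> f x \<sqinter>\<^bsub>M\<^esub> f y \<sqsubseteq>\<^bsub>M\<^esub> f (x \<sqinter>\<^bsub>L\<^esub> y)"
proof -
  interpret L: weak_bounded_lattice L by fact
  interpret M: weak_bounded_lattice M by fact
  have cl: "f a \<in> carrier M" "f' a \<in> carrier M" if "a \<in> carrier L" for a
    using f f' that by (auto simp: adjunction_def)
  have adj: "f a \<sqsubseteq>\<^bsub>M\<^esub> b \<longleftrightarrow> a \<sqsubseteq>\<^bsub>L\<^esub> g b" "f' a \<sqsubseteq>\<^bsub>M\<^esub> b \<longleftrightarrow> a \<sqsubseteq>\<^bsub>L\<^esub> g b"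
    if "a \<in> carrier L" "b \<in> carrier M" for a b
    using f f' that by (auto simp: adjunction_def)
  \<comment> \<open>Two left adjoints of the same \<open>g\<close> are pointwise equivalent: each
    inequality transposes to the unit of the other adjunction.\<close>
  have le: "f a \<sqsubseteq>\<^bsub>M\<^esub> f' a" "f' a \<sqsubseteq>\<^bsub>M\<^esub> f a" if "a \<in> carrier L" for a
    using adj cl that M.le_refl by metis+
  show "\<top>\<^bsub>M\<^esub> \<sqsubseteq>\<^bsub>M\<^esub> f \<top>\<^bsub>L\<^esub>"
    using pres le(2)[OF L.top_closed] cl[OF L.top_closed]
    by (meson M.le_cong_l M.top_closed M.sym preserves_finite_meets_def)
  assume x: "x \<in> carrier L" and y: "y \<in> carrier L"
  note xy = L.meet_closed[OF x y]
  have "f x \<sqinter>\<^bsub>M\<^esub> f y \<sqsubseteq>\<^bsub>M\<^esub> f' x \<sqinter>\<^bsub>M\<^esub> f' y"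
    using cl[OF x] cl[OF y] le[OF x] le[OF y]
    by (meson M.le_trans M.meet_closed M.meet_le M.meet_left M.meet_right)
  also have "f' x \<sqinter>\<^bsub>M\<^esub> f' y .=\<^bsub>M\<^esub> f' (x \<sqinter>\<^bsub>L\<^esub> y)"
    using pres x y cl xy by (simp add: preserves_finite_meets_def M.sym)
  also have "f' (x \<sqinter>\<^bsub>L\<^esub> y) \<sqsubseteq>\<^bsub>M\<^esub> f (x \<sqinter>\<^bsub>L\<^esub> y)"
    using le xy by simp
  finally show "f x \<sqinter>\<^bsub>M\<^esub> f y \<sqsubseteq>\<^bsub>M\<^esub> f (x \<sqinter>\<^bsub>L\<^esub> y)"
    using cl x y xy by simp
qed

theorem theorem3p4p34:
  fixes E :: "('o, 'm) cat" and P :: "('x, 'f, 'o, 'm) cfunctor" and \<pi> :: "'x \<Rightarrow> 'm"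
  assumes "boolean_topos E"
    and "base P = E"
    and "totally_connected P"
    and "fibered_left_adjoint P (sub E) \<pi> (delta P)"
    and "A \<in> Obj E"
    and "\<phi> \<in> carrier (fiber P A)"
  shows "delta P (\<pi> \<phi>) .=\<^bsub>fiber P A\<^esub> neg (fiber P A) (neg (fiber P A) \<phi>)"
proof -
  have P: "tripos P"
    using assms(3) by (simp add: totally_connected_def regular_tripos_def)
  obtain \<pi>' where \<pi>': "fibered_left_adjoint P (sub E) \<pi>' (delta P)"
      "\<And>B. B \<in> Obj E \<Longrightarrow> preserves_finite_meets (fiber P B) (fiber (sub E) B) \<pi>'"
    using assms(2,3) by (auto simp: totally_connected_def)
  have heyt: "heyting_prealgebra (fiber P B)" if "B \<in> Obj E" for B
    using P assms(2) that by (simp add: tripos_def)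
  have bool: "boolean_prealgebra (fiber (sub E) B)" if "B \<in> Obj E" for B
    using assms(1) that by (simp add: boolean_topos_def)
  have lat: "weak_bounded_lattice (fiber P B)" "weak_bounded_lattice (fiber (sub E) B)"
    if "B \<in> Obj E" for B
    using heyt[OF that] bool[OF that] by (simp_all add: boolean_prealgebra_def heyting_prealgebra_def)
  have adj: "adjunction (fiber P B) (fiber (sub E) B) \<pi> (delta P)"
      "adjunction (fiber P B) (fiber (sub E) B) \<pi>' (delta P)" if "B \<in> Obj E" for B
    using assms(2,4) \<pi>'(1) that by (auto simp: fibered_left_adjoint_def)
  note pres = left_adjoint_preserves_finite_meets[OF lat adj \<pi>'(2)]
  interpret S: weak_bounded_lattice "fiber (sub E) A" using lat assms(5) by blast
  interpret L: weak_bounded_lattice "fiber P A" using lat assms(5) by blast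
  show ?thesis
  proof (rule right_left_adjoint_eq_double_neg[OF heyt bool adj(1)])
    \<comment> \<open>The bottom of the subobject fiber is itself a monomorphism into
      \<open>A\<close> that lies below all others, as \<open>delta_bottom_le\<close>
      requires.\<close>
    have "monic E \<bottom>\<^bsub>fiber (sub E) A\<^esub>" "Cod E \<bottom>\<^bsub>fiber (sub E) A\<^esub> = A"
      using S.bottom_closed by simp_all
    then show "delta P \<bottom>\<^bsub>fiber (sub E) A\<^esub> \<sqsubseteq>\<^bsub>fiber P A\<^esub> \<bottom>\<^bsub>fiber P A\<^esub>"
      using delta_bottom_le[OF P, of "\<bottom>\<^bsub>fiber (sub E) A\<^esub>"] assms(1,2)
      by (simp add: boolean_topos_def)
  next
    fix m assume "m \<in> carrier (fiber (sub E) A)"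
    then show "m \<sqsubseteq>\<^bsub>fiber (sub E) A\<^esub> \<pi> (delta P m)"
      using left_adjoint_delta_counit[OF P, of \<pi> m] assms(1,2,4) pres(1) by auto
  qed (use pres(2) assms(5,6) in simp_all)
qed

end
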